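(* Let $n,p\ge1$ and let $\mathcal{H}\in\mathbb{C}^{2n\times2n\times p}$ be a T-Hamiltonian tensor. If $\lambda\in\mathbb{C}$ is a T-eigenvalue of $\mathcal{H}$, then $-\overline{\lambda}$ is also a T-eigenvalue of $\mathcal{H}$.
   Context: A tensor $\mathcal{A}\in\mathbb{C}^{m\times n\times p}$ has frontal slices $\boldsymbol{A}^{(1)},\dots,\boldsymbol{A}^{(p)}\in\mathbb{C}^{m\times n}$. With $\omega=e^{2\pi\sqrt{-1}/p}$, its Fourier-domain slices are $\widehat{\boldsymbol{A}}^{(i)}=\sum_{j=1}^{p}\omega^{(i-1)(j-1)}\boldsymbol{A}^{(j)}$, $i=1,\dots,p$. Let $\operatorname{bcirc}(\mathcal{A})\in\mathbb{C}^{mp\times np}$ be the block circulant matrix whose $(r,s)$ block is $\boldsymbol{A}^{(((r-s)\bmod p)+1)}$. The T-product $\mathcal{A}*\mathcal{B}$ is the tensor with $\operatorname{bcirc}(\mathcal{A}*\mathcal{B})=\operatorname{bcirc}(\mathcal{A})\operatorname{bcirc}(\mathcal{B})$; equivalently, if $\mathcal{C}=\mathcal{A}*\mathcal{B}$ then $\widehat{\boldsymbol{C}}^{(i)}=\widehat{\boldsymbol{A}}^{(i)}\widehat{\boldsymbol{B}}^{(i)}$ for all $i$. The T-conjugate transpose $\mathcal{A}^H$ has frontal slices $(\boldsymbol{A}^{(1)})^H$ for $k=1$ and $(\boldsymbol{A}^{(p-k+2)})^H$ for $k\ge2$ (so that $\operatorname{bcirc}(\mathcal{A}^H)=\operatorname{bcirc}(\mathcal{A})^H$).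 Let $\boldsymbol{J}=\begin{bmatrix}\boldsymbol{0}&\boldsymbol{I}_n\\-\boldsymbol{I}_n&\boldsymbol{0}\end{bmatrix}$. The T-symplectic unit tensor $\mathcal{J}\in\mathbb{R}^{2n\times2n\times p}$ is the tensor all of whose Fourier-domain slices equal $\boldsymbol{J}$. A tensor $\mathcal{H}\in\mathbb{C}^{2n\times2n\times p}$ is T-Hamiltonian if $(\mathcal{J}*\mathcal{H})^H=\mathcal{J}*\mathcal{H}$. A scalar $\lambda\in\mathbb{C}$ is a T-eigenvalue of $\mathcal{A}\in\mathbb{C}^{m\times m\times p}$ if there exists a nonzero tensor $\mathcal{X}\in\mathbb{C}^{m\times1\times p}$ with $\mathcal{A}*\mathcal{X}=\lambda\mathcal{X}$ (equivalently, $\lambda$ is a diagonal entry of the Jordan canonical form of some Fourier-domain slice $\widehat{\boldsymbol{A}}^{(i)}$). *)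

theory Defs
  imports Complex_Main "Jordan_Normal_Form.Schur_Decomposition"
begin

text \<open>A third-order tensor is the list of its frontal slices. Indices are 0-based throughout:
  the slice $A^{(k)}$ is \<open>A ! (k - 1)\<close>.\<close>

type_synonym tensor = "complex mat list"

definition tensor_carrier :: "nat \<Rightarrow> nat \<Rightarrow> nat \<Rightarrow> tensor set" where
  "tensor_carrier m n p = {A. length A = p \<and> set A \<subseteq> carrier_mat m n}"

definition t_rows :: "tensor \<Rightarrow> nat" where "t_rows A = dim_row (hd A)"
definition t_cols :: "tensor \<Rightarrow> nat" where "t_cols A = dim_col (hd A)"

definition t_zero :: "nat \<Rightarrow> nat \<Rightarrow> nat \<Rightarrow> tensor" where
  "t_zero m n p = replicate p (0\<^sub>m m n)"

definition t_smult :: "complex \<Rightarrow> tensor \<Rightarrow> tensor" where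
  "t_smult c A = map (\<lambda>S. c \<cdot>\<^sub>m S) A"

definition fourier_slice :: "tensor \<Rightarrow> nat \<Rightarrow> complex mat" where
  "fourier_slice A i = mat (t_rows A) (t_cols A) (\<lambda>(r, c).
     \<Sum>j<length A. exp (2 * complex_of_real pi * \<i> / of_nat (length A)) ^ (i * j) * (A ! j) $$ (r, c))"

text \<open>Row \<open>a\<close> of the block circulant matrix lies in block row \<open>a div m\<close>. The block difference is
  taken in \<open>int\<close>, so that \<open>mod\<close> wraps around.\<close>

definition bcirc :: "tensor \<Rightarrow> complex mat" where
  "bcirc A = (let m = t_rows A; n = t_cols A; p = length A in
     mat (m * p) (n * p) (\<lambda>(a, b).
       (A ! nat ((int (a div m) - int (b div n)) mod int p)) $$ (a mod m, b mod n)))"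

text \<open>The definite descriptions in \<open>t_prod\<close> and \<open>t_symp_unit\<close> below denote, see \<open>t_prod_unique_ex\<close>
  and \<open>t_symp_unit_unique_ex\<close>.\<close>

definition t_prod :: "tensor \<Rightarrow> tensor \<Rightarrow> tensor" (infixl "*\<^sub>T" 70) where
  "A *\<^sub>T B = (THE C. C \<in> tensor_carrier (t_rows A) (t_cols B) (length A) \<and>
                  bcirc C = bcirc A * bcirc B)"

definition t_adjoint :: "tensor \<Rightarrow> tensor" where
  "t_adjoint A = map (\<lambda>k. mat_adjoint (A ! (if k = 0 then 0 else length A - k))) [0..<length A]"

definition symp_mat :: "nat \<Rightarrow> complex mat" where
  "symp_mat n = four_block_mat (0\<^sub>m n n) (1\<^sub>m n) (- 1\<^sub>m n) (0\<^sub>m n n)"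

definition t_symp_unit :: "nat \<Rightarrow> nat \<Rightarrow> tensor" where
  "t_symp_unit n p = (THE J. J \<in> tensor_carrier (2 * n) (2 * n) p \<and>
                          (\<forall>i<p. fourier_slice J i = symp_mat n))"

definition t_hamiltonian :: "nat \<Rightarrow> nat \<Rightarrow> tensor \<Rightarrow> bool" where
  "t_hamiltonian n p H \<longleftrightarrow> H \<in> tensor_carrier (2 * n) (2 * n) p \<and>
     t_adjoint (t_symp_unit n p *\<^sub>T H) = t_symp_unit n p *\<^sub>T H"

definition t_eigenvalue :: "tensor \<Rightarrow> complex \<Rightarrow> bool" where
  "t_eigenvalue A ev \<longleftrightarrow> (\<exists>X \<in> tensor_carrier (t_rows A) 1 (length A).
     X \<noteq> t_zero (t_rows A) 1 (length A) \<and> A *\<^sub>T X = t_smult ev X)"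

lemma tensor_carrier_nth:
  "A \<in> tensor_carrier m n p \<Longrightarrow> k < p \<Longrightarrow> A ! k \<in> carrier_mat m n"
  by (auto simp: tensor_carrier_def)

lemma tensor_carrier_dims:
  assumes "A \<in> tensor_carrier m n p" "p \<ge> 1"
  shows "t_rows A = m" "t_cols A = n" "length A = p"
proof -
  have "A ! 0 \<in> carrier_mat m n" using assms tensor_carrier_nth by simp
  moreover have "length A = p" using assms by (simp add: tensor_carrier_def)
  ultimately show "t_rows A = m" "t_cols A = n" "length A = p"
    using assms(2) by (cases A; auto simp: t_rows_def t_cols_def)+
qed

lemma bcirc_carrier:
  assumes "A \<in> tensor_carrier m n p" "p \<ge> 1"
  shows "bcirc A \<in> carrier_mat (m * p) (n * p)"
  using tensor_carrier_dims[OF assms] by (simp add: bcirc_def Let_def)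

lemma bcirc_index:
  assumes "A \<in> tensor_carrier m n p" "p \<ge> 1" "r < p" "s < p" "i < m" "j < n"
  shows "bcirc A $$ (r * m + i, s * n + j) = (A ! nat ((int r - int s) mod int p)) $$ (i, j)"
proof -
  have lt: "r * m + i < m * p" if "r < p" "i < m" for r m i
  proof -
    have "r * m + i < (r + 1) * m" using that by simp
    also have "\<dots> \<le> p * m" using that by (intro mult_right_mono) auto
    finally show ?thesis by (simp add: mult.commute)
  qed
  have "r * m + i < m * p" "s * n + j < n * p" using assms lt by auto
  thus ?thesis
    using tensor_carrier_dims[OF assms(1,2)] assms(3-6) by (simp add: bcirc_def Let_def)
qed

lemma bcirc_inject:
  assumes "A \<in> tensor_carrier m n p" "B \<in> tensor_carrier m n p" "p \<ge> 1" "bcirc A = bcirc B"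
  shows "A = B"
proof (rule nth_equalityI)
  have l: "length A = p" "length B = p" using assms by (auto simp: tensor_carrier_def)
  thus "length A = length B" by simp
  fix k assume "k < length A"
  hence k: "k < p" using l by simp
  have d: "A ! k \<in> carrier_mat m n" "B ! k \<in> carrier_mat m n"
    using tensor_carrier_nth assms k by auto
  show "A ! k = B ! k"
  proof (rule eq_matI)
    fix i j assume "i < dim_row (B ! k)" "j < dim_col (B ! k)"
    hence "i < m" "j < n" using d by auto
    thus "(A ! k) $$ (i, j) = (B ! k) $$ (i, j)"
      using bcirc_index[OF assms(1,3) k, of 0 i j] bcirc_index[OF assms(2,3) k, of 0 i j] assms(3,4) k
      by simp
  qed (use d in auto)
qed

lemma sum_blocks: "(\<Sum>t<n * p. f t) = (\<Sum>u<p. \<Sum>c<n. f (u * n + c))" for n p :: nat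
proof -
  have "(\<Sum>t<n * p. f t) = (\<Sum>u<p. sum f {u * n..<u * n + n})"
    using sum.nat_group[of f n p] by (simp add: mult.commute)
  also have "\<dots> = (\<Sum>u<p. \<Sum>c<n. f (u * n + c))"
    by (simp add: sum.atLeastLessThan_shift_0[of f] atLeast0LessThan comp_def)
  finally show ?thesis .
qed

definition t_conv :: "tensor \<Rightarrow> tensor \<Rightarrow> tensor" where
  "t_conv A B = map (\<lambda>k. mat (t_rows A) (t_cols B) (\<lambda>(i, j).
     \<Sum>l<length A. \<Sum>c<t_cols A.
       (A ! nat ((int k - int l) mod int (length A))) $$ (i, c) * (B ! l) $$ (c, j))) [0..<length A]"

lemma t_conv_carrier:
  assumes "A \<in> tensor_carrier m n p" "B \<in> tensor_carrier n q p" "p \<ge> 1"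
  shows "t_conv A B \<in> tensor_carrier m q p"
  using tensor_carrier_dims[OF assms(1,3)] tensor_carrier_dims[OF assms(2,3)]
  by (auto simp: t_conv_def tensor_carrier_def)

lemma bcirc_t_conv:
  assumes A: "A \<in> tensor_carrier m n p" and B: "B \<in> tensor_carrier n q p" and p: "p \<ge> 1"
  shows "bcirc (t_conv A B) = bcirc A * bcirc B"
proof (rule eq_matI)
  note dA = tensor_carrier_dims[OF A p] and dB = tensor_carrier_dims[OF B p]
  note C = t_conv_carrier[OF A B p]
  note cA = bcirc_carrier[OF A p] and cB = bcirc_carrier[OF B p] and cC = bcirc_carrier[OF C p]
  show "dim_row (bcirc (t_conv A B)) = dim_row (bcirc A * bcirc B)"
    "dim_col (bcirc (t_conv A B)) = dim_col (bcirc A * bcirc B)"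
    using cA cB cC by auto
  fix a b assume "a < dim_row (bcirc A * bcirc B)" "b < dim_col (bcirc A * bcirc B)"
  hence a: "a < m * p" and b: "b < q * p" using cA cB by auto
  define r i s j where "r = a div m" "i = a mod m" "s = b div q" "j = b mod q"
  have ri: "a = r * m + i" "b = s * q + j" by (auto simp: r_i_s_j_def)
  have m0: "m > 0" "q > 0" using a b by (auto intro: gr0I)
  have lt: "r < p" "i < m" "s < p" "j < q"
    using a b m0 by (auto simp: r_i_s_j_def less_mult_imp_div_less mult.commute)
  define k where "k = nat ((int r - int s) mod int p)"
  have k: "k < p" "int k = (int r - int s) mod int p" using p by (auto simp: k_def nat_less_iff)
  have "bcirc (t_conv A B) $$ (a, b) = (t_conv A B ! k) $$ (i, j)"
    unfolding ri k_def using bcirc_index[OF C p lt(1,3,2,4)] .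
  also have "\<dots> = (\<Sum>l<p. \<Sum>c<n. (A ! nat ((int k - int l) mod int p)) $$ (i, c) * (B ! l) $$ (c, j))"
    using k lt dA dB by (simp add: t_conv_def)
  also have "\<dots> = (\<Sum>u<p. \<Sum>c<n. (A ! nat ((int r - int u) mod int p)) $$ (i, c) *
                     (B ! nat ((int u - int s) mod int p)) $$ (c, j))"
  proof (rule sum.reindex_bij_witness[of _ "\<lambda>u. nat ((int u - int s) mod int p)"
                                          "\<lambda>l. nat ((int l + int s) mod int p)"])
    fix l assume "l \<in> {..<p}"
    hence l: "l < p" by simp
    show e: "nat ((int (nat ((int l + int s) mod int p)) - int s) mod int p) = l"
      using l p by (simp add: mod_diff_left_eq)
    show "nat ((int l + int s) mod int p) \<in> {..<p}" using p by (simp add: nat_less_iff)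
    have "(int r - int (nat ((int l + int s) mod int p))) mod int p = (int k - int l) mod int p"
    proof -
      have "(int r - int (nat ((int l + int s) mod int p))) mod int p = (int r - (int l + int s)) mod int p"
        using p by (simp add: mod_diff_right_eq)
      also have "\<dots> = ((int r - int s) - int l) mod int p" by (simp add: diff_diff_eq add.commute)
      also have "\<dots> = (int k - int l) mod int p" unfolding k(2) by (simp only: mod_diff_left_eq)
      finally show ?thesis .
    qed
    thus "(\<Sum>c<n. (A ! nat ((int r - int (nat ((int l + int s) mod int p))) mod int p)) $$ (i, c) *
               (B ! nat ((int (nat ((int l + int s) mod int p)) - int s) mod int p)) $$ (c, j)) =
          (\<Sum>c<n. (A ! nat ((int k - int l) mod int p)) $$ (i, c) * (B ! l) $$ (c, j))"
      unfolding e by simp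
  next
    fix u assume "u \<in> {..<p}"
    hence u: "u < p" by simp
    show "nat ((int (nat ((int u - int s) mod int p)) + int s) mod int p) = u"
      using u p by (simp add: mod_add_left_eq)
    show "nat ((int u - int s) mod int p) \<in> {..<p}" using p by (simp add: nat_less_iff)
  qed
  also have "\<dots> = (\<Sum>u<p. \<Sum>c<n. bcirc A $$ (a, u * n + c) * bcirc B $$ (u * n + c, b))"
    unfolding ri using bcirc_index[OF A p] bcirc_index[OF B p] lt by (intro sum.cong refl) simp
  also have "\<dots> = (\<Sum>t<n * p. bcirc A $$ (a, t) * bcirc B $$ (t, b))"
    by (rule sum_blocks[symmetric])
  also have "\<dots> = (bcirc A * bcirc B) $$ (a, b)"
    using cA cB a b by (simp add: scalar_prod_def atLeast0LessThan)
  finally show "bcirc (t_conv A B) $$ (a, b) = (bcirc A * bcirc B) $$ (a, b)" .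
qed

lemma t_prod_unique_ex:
  assumes "A \<in> tensor_carrier m n p" "B \<in> tensor_carrier n q p" "p \<ge> 1"
  shows "\<exists>!C. C \<in> tensor_carrier m q p \<and> bcirc C = bcirc A * bcirc B"
proof (rule ex1I[of _ "t_conv A B"])
  show "t_conv A B \<in> tensor_carrier m q p \<and> bcirc (t_conv A B) = bcirc A * bcirc B"
    using t_conv_carrier[OF assms] bcirc_t_conv[OF assms] by simp
  show "C = t_conv A B" if "C \<in> tensor_carrier m q p \<and> bcirc C = bcirc A * bcirc B" for C
    using that bcirc_inject[of C m q p] t_conv_carrier[OF assms] bcirc_t_conv[OF assms] assms(3) by simp
qed

lemma t_prod_eq_conv:
  assumes "A \<in> tensor_carrier m n p" "B \<in> tensor_carrier n q p" "p \<ge> 1"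
  shows "A *\<^sub>T B = t_conv A B"
  unfolding t_prod_def tensor_carrier_dims[OF assms(1,3)] tensor_carrier_dims[OF assms(2,3)]
  using t_conv_carrier[OF assms] bcirc_t_conv[OF assms] t_prod_unique_ex[OF assms]
  by (intro the1_equality) simp_all

lemma bcirc_t_adjoint:
  assumes A: "A \<in> tensor_carrier m n p" and p: "p \<ge> 1"
  shows "t_adjoint A \<in> tensor_carrier n m p" "bcirc (t_adjoint A) = mat_adjoint (bcirc A)"
proof -
  note dA = tensor_carrier_dims[OF A p]
  have adj: "mat_adjoint M \<in> carrier_mat c r" "mat_adjoint M = mat c r (\<lambda>(i, j). cnj (M $$ (j, i)))"
    if "M \<in> carrier_mat r c" for M :: "complex mat" and r c
    using that by (auto simp: mat_adjoint_def mat_of_rows_def)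
  have "mat_adjoint (A ! (if k = 0 then 0 else length A - k)) \<in> carrier_mat n m" if "k < p" for k
    using that dA by (intro adj(1) tensor_carrier_nth[OF A]) auto
  thus C: "t_adjoint A \<in> tensor_carrier n m p"
    using dA by (auto simp: t_adjoint_def tensor_carrier_def)
  note cA = bcirc_carrier[OF A p] and cC = bcirc_carrier[OF C p]
  show "bcirc (t_adjoint A) = mat_adjoint (bcirc A)"
  proof (rule eq_matI)
    show "dim_row (bcirc (t_adjoint A)) = dim_row (mat_adjoint (bcirc A))"
      "dim_col (bcirc (t_adjoint A)) = dim_col (mat_adjoint (bcirc A))"
      using cC adj(1)[OF cA] by auto
    fix a b assume "a < dim_row (mat_adjoint (bcirc A))" "b < dim_col (mat_adjoint (bcirc A))"
    hence a: "a < n * p" and b: "b < m * p" using adj(1)[OF cA] by auto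
    define r i s j where "r = a div n" "i = a mod n" "s = b div m" "j = b mod m"
    have ri: "a = r * n + i" "b = s * m + j" by (auto simp: r_i_s_j_def)
    have m0: "m > 0" "n > 0" using a b by (auto intro: gr0I)
    have lt: "r < p" "i < n" "s < p" "j < m"
      using a b m0 by (auto simp: r_i_s_j_def less_mult_imp_div_less mult.commute)
    define k where "k = nat ((int r - int s) mod int p)"
    have k: "k < p" "int k = (int r - int s) mod int p" using p by (auto simp: k_def nat_less_iff)
    define k' where "k' = (if k = 0 then 0 else p - k)"
    have k': "k' < p" using k by (auto simp: k'_def)
    have "int k' = (- int k) mod int p"
      using k by (auto simp: k'_def zmod_zminus1_eq_if of_nat_diff)
    also have "\<dots> = (int s - int r) mod int p" unfolding k(2) by (simp add: mod_minus_eq)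
    finally have k'': "nat ((int s - int r) mod int p) = k'" by simp
    have "bcirc (t_adjoint A) $$ (a, b) = (t_adjoint A ! k) $$ (i, j)"
      unfolding ri k_def using bcirc_index[OF C p lt(1,3,2,4)] .
    also have "\<dots> = mat_adjoint (A ! k') $$ (i, j)"
      using k dA by (simp add: t_adjoint_def k'_def)
    also have "\<dots> = cnj ((A ! k') $$ (j, i))"
      using lt by (simp add: adj(2)[OF tensor_carrier_nth[OF A k']])
    also have "\<dots> = cnj (bcirc A $$ (b, a))"
      unfolding ri using bcirc_index[OF A p lt(3,1,4,2)] k'' by simp
    also have "\<dots> = mat_adjoint (bcirc A) $$ (a, b)"
      using a b by (simp add: adj(2)[OF cA])
    finally show "bcirc (t_adjoint A) $$ (a, b) = mat_adjoint (bcirc A) $$ (a, b)" .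
  qed
qed

lemma root_unity_power:
  "p \<ge> 1 \<Longrightarrow> exp (2 * complex_of_real pi * \<i> / of_nat p) ^ p = 1"
  by (simp add: exp_of_nat_mult[symmetric])

lemma sum_root_unity_powers:
  fixes p k :: nat
  defines "w \<equiv> exp (2 * complex_of_real pi * \<i> / of_nat p)"
  assumes "0 < k" "k < p"
  shows "(\<Sum>i<p. w ^ (i * k)) = 0"
proof -
  have w: "w ^ j = cis (2 * pi * real j / real p)" for j
    by (simp add: w_def exp_of_nat_mult[symmetric] cis_conv_exp field_simps)
  have "w ^ k \<noteq> 1"
  proof
    assume "w ^ k = 1"
    hence "cos (2 * pi * real k / real p) = 1" by (simp add: w complex_eq_iff)
    then obtain x :: int where "2 * pi * real k / real p = of_int x * 2 * pi"
      using cos_one_2pi_int by auto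
    hence "real k = of_int x * real p" using assms by (simp add: field_simps)
    hence x: "int k = x * int p" by (metis of_int_eq_iff of_int_mult of_int_of_nat_eq)
    hence "int p dvd int k" by simp
    thus False using assms by (simp add: nat_dvd_not_less)
  qed
  moreover have "w ^ p = 1" using assms root_unity_power[of p] by simp
  hence "(w ^ k) ^ p = 1" by (metis mult.commute power_mult power_one)
  ultimately have "(\<Sum>i<p. (w ^ k) ^ i) = 0" using geometric_sum[of "w ^ k" p] by simp
  thus ?thesis by (simp add: power_mult[symmetric] mult.commute)
qed

lemma fourier_slice_inject:
  assumes A: "A \<in> tensor_carrier m n p" and B: "B \<in> tensor_carrier m n p" and p: "p \<ge> 1"
    and eq: "\<And>i. i < p \<Longrightarrow> fourier_slice A i = fourier_slice B i"
  shows "A = B"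
proof (rule nth_equalityI)
  note dA = tensor_carrier_dims[OF A p] and dB = tensor_carrier_dims[OF B p]
  show "length A = length B" using dA dB by simp
  define w where "w = exp (2 * complex_of_real pi * \<i> / of_nat p)"
  fix k assume "k < length A"
  hence k: "k < p" using dA by simp
  have d: "A ! k \<in> carrier_mat m n" "B ! k \<in> carrier_mat m n"
    using tensor_carrier_nth A B k by auto
  show "A ! k = B ! k"
  proof (rule eq_matI)
    fix r c assume "r < dim_row (B ! k)" "c < dim_col (B ! k)"
    hence rc: "r < m" "c < n" using d by auto
    define f where "f j = (A ! j) $$ (r, c) - (B ! j) $$ (r, c)" for j
    have z: "(\<Sum>j<p. w ^ (i * j) * f j) = 0" if "i < p" for i
    proof -
      have "fourier_slice A i $$ (r, c) = fourier_slice B i $$ (r, c)" using eq that by simp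
      thus ?thesis using dA dB rc
        by (simp add: fourier_slice_def f_def w_def right_diff_distrib sum_subtractf)
    qed
    have wp: "w ^ p = 1"
      unfolding w_def by (rule root_unity_power[OF p])
    have s: "(\<Sum>i<p. w ^ (i * (j + p - k))) = (if j = k then of_nat p else 0)" if j: "j < p" for j
    proof -
      define e where "e = (j + p - k) mod p"
      have "w ^ (j + p - k) = w ^ (p * ((j + p - k) div p) + e)" by (simp add: e_def)
      also have "\<dots> = w ^ e" unfolding power_add power_mult wp by simp
      finally have "w ^ (j + p - k) = w ^ e" .
      hence we: "w ^ (i * (j + p - k)) = w ^ (i * e)" for i
        by (simp only: mult.commute[of i] power_mult)
      show ?thesis
      proof (cases "j = k")
        case True
        hence "e = 0" by (simp add: e_def)
        thus ?thesis using True we by simp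
      next
        case False
        have "e \<noteq> 0"
        proof
          assume "e = 0"
          hence "(j + p - k) mod p = 0" by (simp add: e_def)
          then obtain q where q: "j + p - k = p * q" by (auto elim: dvdE simp: mod_eq_0_iff_dvd)
          have "p * q < p * 2" "p * q > 0" unfolding q[symmetric] using j k by auto
          hence "q = 1" by auto
          thus False using q False k by simp
        qed
        thus ?thesis using sum_root_unity_powers[of e p] False p we
          by (simp add: w_def e_def)
      qed
    qed
    have "0 = (\<Sum>i<p. w ^ (i * (p - k)) * (\<Sum>j<p. w ^ (i * j) * f j))" using z by simp
    also have "\<dots> = (\<Sum>i<p. \<Sum>j<p. w ^ (i * (j + p - k)) * f j)"
    proof -
      have "w ^ (i * (p - k)) * (w ^ (i * j) * f j) = w ^ (i * (j + p - k)) * f j" for i j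
      proof -
        have "j + p - k = (p - k) + j" using k by simp
        hence "i * (j + p - k) = i * (p - k) + i * j" by (simp only: add_mult_distrib2)
        thus ?thesis by (simp add: power_add)
      qed
      thus ?thesis by (simp only: sum_distrib_left)
    qed
    also have "\<dots> = (\<Sum>j<p. (\<Sum>i<p. w ^ (i * (j + p - k))) * f j)"
      by (subst sum.swap) (simp add: sum_distrib_right)
    also have "\<dots> = (\<Sum>j<p. (if j = k then of_nat p else 0) * f j)" using s by simp
    also have "\<dots> = (\<Sum>j<p. if j = k then of_nat p * f k else 0)" by (intro sum.cong) auto
    also have "\<dots> = of_nat p * f k" using k by simp
    finally have "f k = 0" using p by simp
    thus "(A ! k) $$ (r, c) = (B ! k) $$ (r, c)" by (simp add: f_def)
  qed (use d in auto)
qed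

lemma t_symp_unit_unique_ex:
  assumes p: "p \<ge> 1"
  shows "\<exists>!J. J \<in> tensor_carrier (2 * n) (2 * n) p \<and> (\<forall>i<p. fourier_slice J i = symp_mat n)"
    and "t_symp_unit n p = symp_mat n # replicate (p - 1) (0\<^sub>m (2 * n) (2 * n))"
proof -
  let ?J = "symp_mat n # replicate (p - 1) (0\<^sub>m (2 * n) (2 * n))"
  have S: "symp_mat n \<in> carrier_mat (2 * n) (2 * n)"
    unfolding symp_mat_def mult_2 by (intro four_block_carrier_mat) auto
  obtain q where q: "p = Suc q" using p by (cases p) auto
  have C: "?J \<in> tensor_carrier (2 * n) (2 * n) p"
    using S unfolding q tensor_carrier_def by auto
  have dJ: "t_rows ?J = 2 * n" "t_cols ?J = 2 * n" "length ?J = Suc q"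
    using tensor_carrier_dims[OF C p] unfolding q by blast+
  have F: "fourier_slice ?J i = symp_mat n" for i
  proof (rule eq_matI)
    fix r c assume "r < dim_row (symp_mat n)" "c < dim_col (symp_mat n)"
    hence rc: "r < 2 * n" "c < 2 * n" using S by auto
    show "fourier_slice ?J i $$ (r, c) = symp_mat n $$ (r, c)"
      unfolding fourier_slice_def dJ using rc unfolding q
      by (simp add: sum.lessThan_Suc_shift del: sum.lessThan_Suc)
  next
    show "dim_row (fourier_slice ?J i) = dim_row (symp_mat n)"
      unfolding fourier_slice_def dJ using S by simp
    show "dim_col (fourier_slice ?J i) = dim_col (symp_mat n)"
      unfolding fourier_slice_def dJ using S by simp
  qed
  show ex1: "\<exists>!J. J \<in> tensor_carrier (2 * n) (2 * n) p \<and> (\<forall>i<p. fourier_slice J i = symp_mat n)"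
  proof (rule ex1I[of _ ?J])
    fix J assume "J \<in> tensor_carrier (2 * n) (2 * n) p \<and> (\<forall>i<p. fourier_slice J i = symp_mat n)"
    thus "J = ?J" by (intro fourier_slice_inject[OF _ C p]) (simp_all only: F)
  next
    show "?J \<in> tensor_carrier (2 * n) (2 * n) p \<and> (\<forall>i<p. fourier_slice ?J i = symp_mat n)"
      using C F by blast
  qed
  show "t_symp_unit n p = ?J"
    unfolding t_symp_unit_def by (rule the1_equality[OF ex1]) (use C F in blast)
qed

end

theory Submission
  imports Defs
begin

text \<open>T-eigenvalues of a tensor are the eigenvalues of its block circulant matrix: the first
  column of \<open>bcirc X\<close> stacks the slices of \<open>X\<close>. For \<open>M = bcirc H\<close> and \<open>K = bcirc J\<close> the
  Hamiltonian condition says that \<open>K M\<close> is Hermitian, while \<open>K\<^sup>H = - K\<close> and \<open>K\<^sup>2 = - 1\<close>.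
  Hence \<open>M v = \<lambda> v\<close> gives \<open>M\<^sup>H (K v) = - \<lambda> (K v)\<close>, and the eigenvalues of \<open>M\<^sup>H\<close> are the
  conjugates of those of \<open>M\<close>.\<close>

section \<open>Adjoints and eigenvalues of complex matrices\<close>

lemma mat_adjoint_eq:
  fixes A :: "complex mat"
  shows "mat_adjoint A = map_mat cnj (transpose_mat A)"
  by (rule eq_matI) (auto simp: mat_adjoint_def mat_of_rows_def)

lemma mat_adjoint_carrier:
  fixes A :: "complex mat"
  shows "A \<in> carrier_mat m n \<Longrightarrow> mat_adjoint A \<in> carrier_mat n m"
  by (simp add: mat_adjoint_eq)

text \<open>Makes \<open>mat_hom_mult\<close> and \<open>hom_det\<close> available for entrywise
  conjugation, the non-transposing half of \<open>mat_adjoint\<close>.\<close>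

interpretation cnj_hom: comm_ring_hom cnj
  by unfold_locales auto

lemma mat_adjoint_mult:
  fixes A B :: "complex mat"
  assumes "A \<in> carrier_mat m n" "B \<in> carrier_mat n q"
  shows "mat_adjoint (A * B) = mat_adjoint B * mat_adjoint A"
  using assms unfolding mat_adjoint_eq
  by (simp add: transpose_mult[OF assms] cnj_hom.mat_hom_mult[of _ q n _ m])

text \<open>Transposition preserves determinants and conjugation commutes with them, so the
  characteristic determinant of the adjoint at \<open>k\<close> is the conjugate of that of
  \<open>A\<close> at \<open>cnj k\<close>; the two vanish together.\<close>

lemma eigenvalue_mat_adjoint:
  fixes A :: "complex mat"
  assumes A: "A \<in> carrier_mat n n" and "eigenvalue (mat_adjoint A) k"
  shows "eigenvalue A (cnj k)"
proof -
  note A' = mat_adjoint_carrier[OF A]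
  have "char_matrix (mat_adjoint A) k = map_mat cnj (transpose_mat (char_matrix A (cnj k)))"
    using A by (intro eq_matI) (auto simp: char_matrix_def mat_adjoint_eq)
  hence "det (char_matrix (mat_adjoint A) k) = cnj (det (char_matrix A (cnj k)))"
    using A by (simp add: cnj_hom.hom_det det_transpose[of _ n])
  thus ?thesis
    using assms(2) by (simp add: eigenvalue_det[OF A] eigenvalue_det[OF A'])
qed

lemma eigenvalue_hamiltonian_mat:
  fixes M K :: "complex mat"
  assumes M: "M \<in> carrier_mat N N" and K: "K \<in> carrier_mat N N"
    and skew: "mat_adjoint K = - K" and sq: "K * K = - 1\<^sub>m N"
    and herm: "mat_adjoint (K * M) = K * M" and ev: "eigenvalue M k"
  shows "eigenvalue M (- cnj k)"
proof -
  note M' = mat_adjoint_carrier[OF M]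
  from ev obtain v where v: "v \<in> carrier_vec N" "v \<noteq> 0\<^sub>v N" "M *\<^sub>v v = k \<cdot>\<^sub>v v"
    using M by (auto simp: eigenvalue_def eigenvector_def)
  have Kv: "K *\<^sub>v v \<in> carrier_vec N" using K v by simp
  \<comment> \<open>The adjoint of \<open>K * M\<close> is
    \<open>mat_adjoint M * mat_adjoint K\<close>, and skewness of \<open>K\<close> supplies the
    sign.\<close>
  have "- (mat_adjoint M * K) = K * M"
    using herm M' K by (simp add: mat_adjoint_mult[OF K M] skew)
  hence MK: "mat_adjoint M * K = - (K * M)" by (metis uminus_uminus_mat)
  have "mat_adjoint M *\<^sub>v (K *\<^sub>v v) = (mat_adjoint M * K) *\<^sub>v v"
    using assoc_mult_mat_vec[OF M' K v(1)] by simp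
  also have "\<dots> = - (K *\<^sub>v (M *\<^sub>v v))"
    unfolding MK using K M v(1) by (simp add: assoc_mult_mat_vec[OF K M v(1)])
  also have "\<dots> = (- k) \<cdot>\<^sub>v (K *\<^sub>v v)"
    unfolding v(3) mult_mat_vec[OF K v(1)] using K by (intro eq_vecI) auto
  finally have eq: "mat_adjoint M *\<^sub>v (K *\<^sub>v v) = (- k) \<cdot>\<^sub>v (K *\<^sub>v v)" .
  \<comment> \<open>\<open>K\<close> is injective: applying it a second time to \<open>v\<close>
    returns \<open>- v\<close>.\<close>
  have "K *\<^sub>v v \<noteq> 0\<^sub>v N"
  proof
    assume "K *\<^sub>v v = 0\<^sub>v N"
    hence "(K * K) *\<^sub>v v = 0\<^sub>v N"
      using K by (simp add: assoc_mult_mat_vec[OF K K v(1)]) (intro eq_vecI; simp)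
    hence "- v = 0\<^sub>v N" using v(1) by (simp add: sq)
    thus False using v by (simp add: uminus_zero_vec_eq)
  qed
  hence "eigenvalue (mat_adjoint M) (- k)"
    unfolding eigenvalue_def eigenvector_def using eq Kv M' by auto
  from eigenvalue_mat_adjoint[OF M this] show ?thesis by simp
qed

section \<open>Column tensors as first columns of their block circulants\<close>

lemma col_bcirc_index:
  assumes "X \<in> tensor_carrier m 1 p" "p \<ge> 1" "r < p" "i < m"
  shows "col (bcirc X) 0 $ (r * m + i) = (X ! r) $$ (i, 0)"
proof -
  have "r * m + i < Suc r * m" using assms by simp
  also have "\<dots> \<le> p * m" using assms by (intro mult_right_mono) auto
  finally have "r * m + i < m * p" by (simp add: mult.commute)
  \<comment> \<open>Column 0 lies in block column 0, so the slice index is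
    \<open>(r - 0) mod p\<close>, which is \<open>r\<close>.\<close>
  thus ?thesis
    using bcirc_carrier[OF assms(1,2)] bcirc_index[OF assms(1-3), of 0 i 0] assms by simp
qed

lemma col_bcirc_inject:
  assumes X: "X \<in> tensor_carrier m 1 p" and Y: "Y \<in> tensor_carrier m 1 p" and p: "p \<ge> 1"
    and eq: "col (bcirc X) 0 = col (bcirc Y) 0"
  shows "X = Y"
proof (rule nth_equalityI)
  have l: "length X = p" "length Y = p" using X Y by (auto simp: tensor_carrier_def)
  thus "length X = length Y" by simp
  fix k assume "k < length X"
  hence k: "k < p" using l by simp
  note d = tensor_carrier_nth[OF X k] tensor_carrier_nth[OF Y k]
  show "X ! k = Y ! k"
    using d col_bcirc_index[OF X p k] col_bcirc_index[OF Y p k] eq by (intro eq_matI) auto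
qed

text \<open>Cutting \<open>v\<close> into \<open>p\<close> consecutive blocks of length
  \<open>m\<close> gives the slices. This turns an eigenvector of a block circulant matrix back into
  a tensor.\<close>

lemma col_bcirc_surj:
  assumes v: "v \<in> carrier_vec (m * p)" and p: "p \<ge> 1"
  obtains X where "X \<in> tensor_carrier m 1 p" "col (bcirc X) 0 = v"
proof
  let ?X = "map (\<lambda>r. mat m 1 (\<lambda>(i, j). v $ (r * m + i))) [0..<p]"
  show X: "?X \<in> tensor_carrier m 1 p" by (auto simp: tensor_carrier_def)
  show "col (bcirc ?X) 0 = v"
  proof (rule eq_vecI)
    show "dim_vec (col (bcirc ?X) 0) = dim_vec v" using bcirc_carrier[OF X p] v by simp
    fix a assume "a < dim_vec v"
    hence a: "a < m * p" using v by simp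
    hence "m > 0" by (auto intro: gr0I)
    hence "a div m < p" "a mod m < m"
      using a by (auto simp: less_mult_imp_div_less mult.commute)
    with col_bcirc_index[OF X p this] show "col (bcirc ?X) 0 $ a = v $ a" by simp
  qed
qed

lemma bcirc_t_smult:
  assumes X: "X \<in> tensor_carrier m n p" and p: "p \<ge> 1"
  shows "t_smult c X \<in> tensor_carrier m n p" "bcirc (t_smult c X) = c \<cdot>\<^sub>m bcirc X"
proof -
  show C: "t_smult c X \<in> tensor_carrier m n p"
    using X by (auto simp: t_smult_def tensor_carrier_def)
  note dX = tensor_carrier_dims[OF X p] and dC = tensor_carrier_dims[OF C p]
  show "bcirc (t_smult c X) = c \<cdot>\<^sub>m bcirc X"
  proof (rule eq_matI)
    show "dim_row (bcirc (t_smult c X)) = dim_row (c \<cdot>\<^sub>m bcirc X)"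
      "dim_col (bcirc (t_smult c X)) = dim_col (c \<cdot>\<^sub>m bcirc X)"
      using bcirc_carrier[OF X p] bcirc_carrier[OF C p] by auto
    fix a b assume "a < dim_row (c \<cdot>\<^sub>m bcirc X)" "b < dim_col (c \<cdot>\<^sub>m bcirc X)"
    hence ab: "a < m * p" "b < n * p" using bcirc_carrier[OF X p] by auto
    hence "m > 0" "n > 0" by (auto intro: gr0I)
    moreover have k: "nat ((int (a div m) - int (b div n)) mod int p) < p" (is "?k < p")
      using p by (simp add: nat_less_iff)
    moreover note tensor_carrier_nth[OF X k]
    ultimately show "bcirc (t_smult c X) $$ (a, b) = (c \<cdot>\<^sub>m bcirc X) $$ (a, b)"
      using ab dX dC by (simp add: bcirc_def Let_def) (simp add: t_smult_def)
  qed
qed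

text \<open>Column 0 of \<open>bcirc A * bcirc X\<close> is \<open>bcirc A\<close> applied to column
  0 of \<open>bcirc X\<close>. Since passing from \<open>X\<close> to that column is a linear
  bijection, the tensor equation and the matrix eigenvector equation have the same nonzero
  solutions.\<close>

lemma t_eigenvalue_iff_bcirc:
  assumes A: "A \<in> tensor_carrier m m p" and p: "p \<ge> 1"
  shows "t_eigenvalue A k \<longleftrightarrow> eigenvalue (bcirc A) k"
proof -
  note dA = tensor_carrier_dims[OF A p] and cA = bcirc_carrier[OF A p]
  have zero: "t_zero m 1 p \<in> tensor_carrier m 1 p"
    by (auto simp: t_zero_def tensor_carrier_def)
  have zero': "col (bcirc (t_zero m 1 p)) 0 = 0\<^sub>v (m * p)"
  proof -
    \<comment> \<open>The zero tensor is 0 times itself, so homogeneity of \<open>bcirc\<close>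
      makes its first column vanish.\<close>
    have "t_smult 0 (t_zero m 1 p) = t_zero m 1 p" by (simp add: t_smult_def t_zero_def)
    hence "bcirc (t_zero m 1 p) = 0 \<cdot>\<^sub>m bcirc (t_zero m 1 p)"
      using bcirc_t_smult(2)[OF zero p, of 0] by simp
    also have "col \<dots> 0 = 0\<^sub>v (m * p)"
      using bcirc_carrier[OF zero p] p by (intro eq_vecI) auto
    finally show ?thesis .
  qed
  have key: "(X \<noteq> t_zero m 1 p \<and> A *\<^sub>T X = t_smult k X)
      \<longleftrightarrow> eigenvector (bcirc A) (col (bcirc X) 0) k"
    if X: "X \<in> tensor_carrier m 1 p" for X
  proof -
    note cX = bcirc_carrier[OF X p]
    have "col (bcirc (A *\<^sub>T X)) 0 = bcirc A *\<^sub>v col (bcirc X) 0"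
      unfolding t_prod_eq_conv[OF A X p] bcirc_t_conv[OF A X p]
      using col_mult2[OF cA cX, of 0] p by simp
    moreover have "col (bcirc (t_smult k X)) 0 = k \<cdot>\<^sub>v col (bcirc X) 0"
      unfolding bcirc_t_smult(2)[OF X p] using cX p by (intro eq_vecI) auto
    moreover have "A *\<^sub>T X \<in> tensor_carrier m 1 p"
      unfolding t_prod_eq_conv[OF A X p] by (rule t_conv_carrier[OF A X p])
    \<comment> \<open>Both sides lie in \<open>tensor_carrier m 1 p\<close>, where equality can be
      tested on the first column.\<close>
    ultimately have "A *\<^sub>T X = t_smult k X \<longleftrightarrow>
        bcirc A *\<^sub>v col (bcirc X) 0 = k \<cdot>\<^sub>v col (bcirc X) 0"
      using col_bcirc_inject[OF _ bcirc_t_smult(1)[OF X p] p] by metis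
    moreover have "X = t_zero m 1 p \<longleftrightarrow> col (bcirc X) 0 = 0\<^sub>v (m * p)"
      using col_bcirc_inject[OF X zero p] zero' by auto
    moreover have "col (bcirc X) 0 \<in> carrier_vec (m * p)" using cX by (intro carrier_vecI) simp
    ultimately show ?thesis using cA by (simp add: eigenvector_def)
  qed
  have "t_eigenvalue A k \<longleftrightarrow>
      (\<exists>X \<in> tensor_carrier m 1 p. eigenvector (bcirc A) (col (bcirc X) 0) k)"
    unfolding t_eigenvalue_def dA using key by auto
  also have "\<dots> \<longleftrightarrow> eigenvalue (bcirc A) k"
  proof
    assume "eigenvalue (bcirc A) k"
    then obtain v where v: "eigenvector (bcirc A) v k" by (auto simp: eigenvalue_def)
    hence "v \<in> carrier_vec (m * p)" using cA by (simp add: eigenvector_def)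
    from col_bcirc_surj[OF this p] v
    show "\<exists>X \<in> tensor_carrier m 1 p. eigenvector (bcirc A) (col (bcirc X) 0) k" by metis
  qed (auto simp: eigenvalue_def)
  finally show ?thesis .
qed

section \<open>The block circulant matrix of the T-symplectic unit\<close>

lemma symp_mat_carrier: "symp_mat n \<in> carrier_mat (2 * n) (2 * n)"
  unfolding symp_mat_def mult_2 by (intro four_block_carrier_mat) auto

lemma symp_mat_skew: "mat_adjoint (symp_mat n) = - symp_mat n"
  by (rule eq_matI) (auto simp: mat_adjoint_eq symp_mat_def)

lemma symp_mat_square: "symp_mat n * symp_mat n = - 1\<^sub>m (2 * n)"
proof -
  have "symp_mat n * symp_mat n =
      four_block_mat (- 1\<^sub>m n) (0\<^sub>m n n) (0\<^sub>m n n) (- 1\<^sub>m n)"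
    unfolding symp_mat_def by (subst mult_four_block_mat) auto
  also have "\<dots> = - 1\<^sub>m (2 * n)" by (rule eq_matI) auto
  finally show ?thesis .
qed

lemma t_symp_unit_nth:
  assumes "p \<ge> 1" "k < p"
  shows "t_symp_unit n p ! k = (if k = 0 then symp_mat n else 0\<^sub>m (2 * n) (2 * n))"
  using assms by (simp add: t_symp_unit_unique_ex(2) nth_Cons')

lemma t_symp_unit_carrier:
  assumes "p \<ge> 1"
  shows "t_symp_unit n p \<in> tensor_carrier (2 * n) (2 * n) p"
  using t_symp_unit_unique_ex(2)[OF assms] symp_mat_carrier assms
  by (auto simp: tensor_carrier_def)

text \<open>Only slice 0 of the unit can be nonzero, and block \<open>(r, s)\<close> holds slice
  \<open>(r - s) mod p\<close>; hence the matrix is block diagonal with \<open>p\<close> copies of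
  \<open>symp_mat n\<close>.\<close>

lemma bcirc_t_symp_unit_index:
  assumes p: "p \<ge> 1" and a: "a < 2 * n * p" and b: "b < 2 * n * p"
  shows "bcirc (t_symp_unit n p) $$ (a, b) =
    (if a div (2 * n) = b div (2 * n) then symp_mat n $$ (a mod (2 * n), b mod (2 * n)) else 0)"
proof -
  note d = tensor_carrier_dims[OF t_symp_unit_carrier[OF p, of n] p]
  have n: "n > 0" using a by (auto intro: gr0I)
  define r s where "r = a div (2 * n)" "s = b div (2 * n)"
  have rs: "r < p" "s < p"
    using a b unfolding r_s_def by (auto simp: less_mult_imp_div_less mult.commute)
  define k where "k = nat ((int r - int s) mod int p)"
  have k: "k < p" using p by (simp add: k_def nat_less_iff)
  \<comment> \<open>As \<open>r\<close> and \<open>s\<close> are both below \<open>p\<close>, they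
    are congruent modulo \<open>p\<close> only if equal.\<close>
  have "k = 0 \<longleftrightarrow> (int r - int s) mod int p = 0"
    using p pos_mod_sign[of "int p" "int r - int s"] unfolding k_def by linarith
  also have "\<dots> \<longleftrightarrow> int r mod int p = int s mod int p"
    by (simp add: mod_eq_dvd_iff mod_eq_0_iff_dvd)
  finally have "k = 0 \<longleftrightarrow> r = s" using rs by simp
  thus ?thesis
    using a b n d t_symp_unit_nth[OF p k, of n] by (simp add: bcirc_def Let_def r_s_def k_def)
qed

text \<open>The adjoint of a block diagonal matrix is taken block by block, so skewness is inherited
  from \<open>symp_mat n\<close>.\<close>

lemma bcirc_t_symp_unit_skew:
  assumes p: "p \<ge> 1"
  shows "mat_adjoint (bcirc (t_symp_unit n p)) = - bcirc (t_symp_unit n p)"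
proof (rule eq_matI)
  let ?K = "bcirc (t_symp_unit n p)"
  note cK = bcirc_carrier[OF t_symp_unit_carrier[OF p, of n] p]
  show "dim_row (mat_adjoint ?K) = dim_row (- ?K)" "dim_col (mat_adjoint ?K) = dim_col (- ?K)"
    using cK by (auto simp: mat_adjoint_eq)
  fix a b assume "a < dim_row (- ?K)" "b < dim_col (- ?K)"
  hence ab: "a < 2 * n * p" "b < 2 * n * p" using cK by auto
  hence n: "n > 0" by (auto intro: gr0I)
  have "mat_adjoint (symp_mat n) $$ (a mod (2 * n), b mod (2 * n)) =
      (- symp_mat n) $$ (a mod (2 * n), b mod (2 * n))"
    by (simp add: symp_mat_skew)
  hence "cnj (symp_mat n $$ (b mod (2 * n), a mod (2 * n))) =
      - symp_mat n $$ (a mod (2 * n), b mod (2 * n))"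
    using symp_mat_carrier[of n] n by (simp add: mat_adjoint_eq)
  thus "mat_adjoint ?K $$ (a, b) = (- ?K) $$ (a, b)"
    using ab cK by (simp add: mat_adjoint_eq bcirc_t_symp_unit_index[OF p])
qed

text \<open>Block diagonal matrices multiply block by block, so the identity reduces to
  \<open>symp_mat_square\<close>.\<close>

lemma bcirc_t_symp_unit_square:
  assumes p: "p \<ge> 1"
  shows "bcirc (t_symp_unit n p) * bcirc (t_symp_unit n p) = - 1\<^sub>m (2 * n * p)"
proof (rule eq_matI)
  let ?K = "bcirc (t_symp_unit n p)" and ?m = "2 * n" and ?S = "symp_mat n"
  note cK = bcirc_carrier[OF t_symp_unit_carrier[OF p, of n] p]
  show "dim_row (?K * ?K) = dim_row (- 1\<^sub>m (?m * p))" "dim_col (?K * ?K) = dim_col (- 1\<^sub>m (?m * p))"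
    using cK by auto
  fix a b assume "a < dim_row (- 1\<^sub>m (?m * p))" "b < dim_col (- 1\<^sub>m (?m * p))"
  hence ab: "a < ?m * p" "b < ?m * p" by auto
  hence n: "n > 0" by (auto intro: gr0I)
  define r s i j where rs: "r = a div ?m" "s = b div ?m" "i = a mod ?m" "j = b mod ?m"
  have lt: "r < p" "i < ?m" "j < ?m"
    using ab n unfolding rs by (auto simp: less_mult_imp_div_less mult.commute)
  have lt': "u * ?m + c < ?m * p" if "u < p" "c < ?m" for u c
  proof -
    have "u * ?m + c < Suc u * ?m" using that by simp
    also have "\<dots> \<le> p * ?m" using that by (intro mult_right_mono) auto
    finally show ?thesis by (simp add: mult.commute)
  qed
  have K: "?K $$ (a, u * ?m + c) = (if r = u then ?S $$ (i, c) else 0)"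
    "?K $$ (u * ?m + c, b) = (if u = s then ?S $$ (c, j) else 0)" if "u < p" "c < ?m" for u c
    using bcirc_t_symp_unit_index[OF p ab(1) lt'[OF that]]
      bcirc_t_symp_unit_index[OF p lt'[OF that] ab(2)] that(2) by (simp_all add: rs)
  have "(?K * ?K) $$ (a, b) = (\<Sum>t<?m * p. ?K $$ (a, t) * ?K $$ (t, b))"
    using cK ab by (simp add: scalar_prod_def atLeast0LessThan)
  also have "\<dots> = (\<Sum>u<p. \<Sum>c<?m. ?K $$ (a, u * ?m + c) * ?K $$ (u * ?m + c, b))"
    by (rule sum_blocks)
  \<comment> \<open>Row \<open>a\<close> of the first factor vanishes outside block
    \<open>r\<close>, so only \<open>u = r\<close> contributes; the second factor then forces
    \<open>r = s\<close>.\<close>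
  also have "\<dots> = (\<Sum>u<p. if r = u then \<Sum>c<?m. ?S $$ (i, c) * (if u = s then ?S $$ (c, j) else 0) else 0)"
    by (intro sum.cong refl) (auto simp: K)
  also have "\<dots> = (if r = s then \<Sum>c<?m. ?S $$ (i, c) * ?S $$ (c, j) else 0)"
    using lt by simp
  also have "(\<Sum>c<?m. ?S $$ (i, c) * ?S $$ (c, j)) = (?S * ?S) $$ (i, j)"
    using symp_mat_carrier[of n] lt by (simp add: scalar_prod_def atLeast0LessThan)
  also have "\<dots> = (if i = j then - 1 else 0)" using lt by (simp add: symp_mat_square)
  also have "(if r = s then if i = j then - 1 else 0 else 0) = (- 1\<^sub>m (?m * p) :: complex mat) $$ (a, b)"
  proof -
    \<comment> \<open>Quotient and remainder modulo \<open>2 * n\<close> together determine an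
      index, so the surviving entries are exactly the diagonal ones.\<close>
    have "a = b \<longleftrightarrow> r = s \<and> i = j" unfolding rs by (metis div_mult_mod_eq)
    thus ?thesis using ab by auto
  qed
  finally show "(?K * ?K) $$ (a, b) = (- 1\<^sub>m (?m * p)) $$ (a, b)" .
qed

theorem theorem3p9:
  fixes n p :: nat and H :: tensor and ev :: complex
  assumes "n \<ge> 1" and "p \<ge> 1"
    and "t_hamiltonian n p H"
    and "t_eigenvalue H ev"
  shows "t_eigenvalue H (- cnj ev)"
proof -
  note p = assms(2)
  have H: "H \<in> tensor_carrier (2 * n) (2 * n) p"
    and herm: "t_adjoint (t_symp_unit n p *\<^sub>T H) = t_symp_unit n p *\<^sub>T H"
    using assms(3) by (auto simp: t_hamiltonian_def)
  note J = t_symp_unit_carrier[OF p, of n]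
  \<comment> \<open>\<open>bcirc\<close> carries the T-product and \<open>t_adjoint\<close> to the
    matrix product and adjoint, so the tensor condition becomes a Hermitian matrix
    condition.\<close>
  have "mat_adjoint (bcirc (t_symp_unit n p) * bcirc H) = bcirc (t_symp_unit n p) * bcirc H"
    using herm bcirc_t_adjoint(2)[OF t_conv_carrier[OF J H p] p]
    by (simp only: t_prod_eq_conv[OF J H p] bcirc_t_conv[OF J H p])
  moreover have "eigenvalue (bcirc H) ev"
    using assms(4) by (simp add: t_eigenvalue_iff_bcirc[OF H p])
  ultimately have "eigenvalue (bcirc H) (- cnj ev)"
    using eigenvalue_hamiltonian_mat[OF bcirc_carrier[OF H p] bcirc_carrier[OF J p]
        bcirc_t_symp_unit_skew[OF p] bcirc_t_symp_unit_square[OF p]] by blast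
  thus ?thesis by (simp add: t_eigenvalue_iff_bcirc[OF H p])
qed

end
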